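(* Let $\mathcal{T}$ be a finite set of Wang tiles and let $\tilde{\mathcal{A}}=\mathcal{H}\times\mathcal{W}$ with $\mathcal{H}=\{1,\dots,n_{\mathrm h}\}$, $\mathcal{W}=\{1,\dots,n_{\mathrm w}\}$ be an initially void rectangular domain. Cover each odd row of $\tilde{\mathcal{A}}$ by a maximum row cover, and let $|\tilde{\mathcal{B}}_{\mathrm{cov}}|$ be the number of tiles placed. Then $|\tilde{\mathcal{B}}_{\mathrm{cov}}|\ge \tfrac12|\tilde{\mathcal{B}}_{\max\mathrm{cov}}|$, where $|\tilde{\mathcal{B}}_{\max\mathrm{cov}}|$ is the number of tiles in a maximum cover of $\tilde{\mathcal{A}}$ by $\mathcal{T}$.
   Context: A Wang tile $k$ is a quadruple of colors $(c_k^{\mathrm n},c_k^{\mathrm w},c_k^{\mathrm s},c_k^{\mathrm e})$ from a finite color set $\mathcal{C}$ (north, west, south, east edge of a non-rotatable unit square). Coordinate $(i,j)$ denotes row $i$ (counted downwards) and column $j$ (counted to the right). A cover of $\tilde{\mathcal{A}}$ assigns to each coordinate either a tile of $\mathcal{T}$ or a void, such that any two horizontally or vertically adjacent coordinates that both carry tiles have equal colors on their shared edge: $c^{\mathrm e}$ of the tile at $(i,j)$ equals $c^{\mathrm w}$ of the tile at $(i,j+1)$, and $c^{\mathrm s}$ of the tile at $(i,j)$ equals $c^{\mathrm n}$ of the tile at $(i+1,j)$. No condition is imposed between a tile and a void or between two voids. A maximum cover is a cover with the largest possible number of tiles. A maximum row cover is a maximum cover of a single row $\{i\}\times\mathcal{W}$,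 considered on its own (only horizontal matching is relevant). *)

theory Defs
  imports Complex_Main
begin

datatype 'c wang_tile = Wang_Tile (north: 'c) (west: 'c) (south: 'c) (east: 'c)

text \<open>Coordinates are pairs (row counted downwards, column counted to the right).
  In a partial map from coordinates to tiles, \<^term>\<open>None\<close> is a void, so the number of
  tiles of a cover \<open>B\<close> is \<open>card (dom B)\<close>.\<close>

definition is_cover ::
  "'c wang_tile set \<Rightarrow> (nat \<times> nat) set \<Rightarrow> (nat \<times> nat \<rightharpoonup> 'c wang_tile) \<Rightarrow> bool" where
  "is_cover T A B \<longleftrightarrow>
     dom B \<subseteq> A \<and> ran B \<subseteq> T \<and>
     (\<forall>i j s t. B (i, j) = Some s \<and> B (i, j + 1) = Some t \<longrightarrow> east s = west t) \<and>
     (\<forall>i j s t. B (i, j) = Some s \<and> B (i + 1, j) = Some t \<longrightarrow> south s = north t)"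

definition is_max_cover ::
  "'c wang_tile set \<Rightarrow> (nat \<times> nat) set \<Rightarrow> (nat \<times> nat \<rightharpoonup> 'c wang_tile) \<Rightarrow> bool" where
  "is_max_cover T A B \<longleftrightarrow>
     is_cover T A B \<and> (\<forall>B'. is_cover T A B' \<longrightarrow> card (dom B') \<le> card (dom B))"

text \<open>In a single row the vertical condition of \<^const>\<open>is_cover\<close> is vacuous.\<close>

definition is_max_row_cover ::
  "'c wang_tile set \<Rightarrow> nat \<Rightarrow> nat set \<Rightarrow> (nat \<times> nat \<rightharpoonup> 'c wang_tile) \<Rightarrow> bool" where
  "is_max_row_cover T i W B \<longleftrightarrow> is_max_cover T ({i} \<times> W) B"

text \<open>The domain is void initially, so only odd rows carry tiles afterwards; the
  maximum row covers of different rows are chosen independently of each other.\<close>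

definition is_odd_rows_max_cover ::
  "'c wang_tile set \<Rightarrow> nat set \<Rightarrow> nat set \<Rightarrow> (nat \<times> nat \<rightharpoonup> 'c wang_tile) \<Rightarrow> bool" where
  "is_odd_rows_max_cover T H W B \<longleftrightarrow>
     dom B \<subseteq> {i \<in> H. odd i} \<times> W \<and>
     (\<forall>i\<in>H. odd i \<longrightarrow> is_max_row_cover T i W (B |` ({i} \<times> W)))"

lemma is_max_cover_exists:
  assumes "finite A"
  shows "\<exists>B. is_max_cover T A B"
proof -
  have ex: "is_cover T A Map.empty"
    by (simp add: is_cover_def)
  have bd: "\<forall>B. is_cover T A B \<longrightarrow> card (dom B) \<le> card A"
    using assms by (auto simp: is_cover_def intro: card_mono)
  show ?thesis
    using Lattices_Big.ex_has_greatest_nat[of "is_cover T A" "Map.empty" "\<lambda>B. card (dom B)" "Suc (card A)"] ex bd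
    unfolding is_max_cover_def by (meson le_SucI le_imp_less_Suc)
qed

end

theory Submission
  imports Defs
begin

text \<open>A row cover can be translated to any other row, so all maximum row covers have the same
  number \<open>m\<close> of tiles. Every row of a cover of the rectangle is itself a row cover, hence a
  maximum cover has at most \<open>n\<^sub>h * m\<close> tiles, while the odd rows, which make up at least half of
  all rows, receive exactly \<open>m\<close> tiles each.\<close>

text \<open>Voids impose no matching condition, so deleting tiles cannot break a cover.\<close>

lemma is_cover_restrict:
  assumes "is_cover T A B"
  shows "is_cover T (A \<inter> S) (B |` S)"
  using assms unfolding is_cover_def
  by (auto simp: restrict_map_def ran_def split: if_splits)

text \<open>Horizontal matching does not depend on the row index, and a single row contains no
  vertically adjacent pair of tiles.\<close>

lemma is_cover_translate_row:
  assumes "is_cover T ({i} \<times> W) B"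
  obtains B' where "is_cover T ({k} \<times> W) B'" "card (dom B') = card (dom B)"
proof
  let ?B' = "\<lambda>(r, c). if r = k then B (i, c) else None"
  show "is_cover T ({k} \<times> W) ?B'"
    using assms unfolding is_cover_def
    by (fastforce simp: ran_def split: if_splits)
  have "dom B = (\<lambda>(r, c). (i, c)) ` dom ?B'"
    using assms unfolding is_cover_def by (force simp: image_iff split: if_splits)
  \<comment> \<open>The map overwrites the row index, but all tiles of \<open>?B'\<close> lie in row
    \<open>k\<close>, so the column alone determines the coordinate.\<close>
  moreover have "inj_on (\<lambda>(r, c). (i, c)) (dom ?B')"
    by (auto simp: inj_on_def split: if_splits)
  ultimately show "card (dom ?B') = card (dom B)"
    by (simp add: card_image)
qed

text \<open>Translating the competitor into row \<open>i\<close> makes maximality there applicable,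
  so row maxima can be compared across rows.\<close>

lemma is_max_row_cover_card_ge:
  assumes "is_max_row_cover T i W B" and "is_cover T ({k} \<times> W) B'"
  shows "card (dom B') \<le> card (dom B)"
proof -
  obtain B'' where "is_cover T ({i} \<times> W) B''" "card (dom B'') = card (dom B')"
    using is_cover_translate_row[OF assms(2)] .
  then show ?thesis
    using assms(1) unfolding is_max_row_cover_def is_max_cover_def by metis
qed

lemma card_dom_eq_sum_rows:
  assumes "finite H" and "finite W" and "dom B \<subseteq> H \<times> W"
  shows "card (dom B) = (\<Sum>i\<in>H. card (dom (B |` ({i} \<times> W))))"
proof -
  have "dom B = (\<Union>i\<in>H. dom (B |` ({i} \<times> W)))"
    using assms(3) by auto
  also have "card \<dots> = (\<Sum>i\<in>H. card (dom (B |` ({i} \<times> W))))"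
    using assms by (intro card_UN_disjoint) (auto intro: finite_subset[of _ "H \<times> W"])
  finally show ?thesis .
qed

text \<open>Counting starts at the odd number 1, hence the rounding up.\<close>

lemma card_odd_atLeastAtMost: "card {i \<in> {1..n}. odd i} = (n + 1) div 2"
proof (induction n)
  case (Suc n)
  have "{i \<in> {1..Suc n}. odd i} =
      (if odd (Suc n) then insert (Suc n) {i \<in> {1..n}. odd i} else {i \<in> {1..n}. odd i})"
    by (auto simp: le_Suc_eq)
  then show ?case
    using Suc by (auto elim: evenE oddE)
qed simp

theorem proposition4p2:
  fixes C :: "'c set" and T :: "'c wang_tile set" and n\<^sub>h n\<^sub>w :: nat
    and B\<^sub>c\<^sub>o\<^sub>v B\<^sub>m\<^sub>a\<^sub>x :: "nat \<times> nat \<rightharpoonup> 'c wang_tile"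
  assumes "finite C"
    and "\<forall>t\<in>T. set_wang_tile t \<subseteq> C"
    and "finite T"
    and "is_odd_rows_max_cover T {1..n\<^sub>h} {1..n\<^sub>w} B\<^sub>c\<^sub>o\<^sub>v"
    and "is_max_cover T ({1..n\<^sub>h} \<times> {1..n\<^sub>w}) B\<^sub>m\<^sub>a\<^sub>x"
  shows "real (card (dom B\<^sub>c\<^sub>o\<^sub>v)) \<ge> 1 / 2 * real (card (dom B\<^sub>m\<^sub>a\<^sub>x))"
proof -
  let ?W = "{1..n\<^sub>w}" and ?O = "{i \<in> {1..n\<^sub>h}. odd i}"
  \<comment> \<open>Row 1 serves only as a reference for the common value \<open>m\<close>;
    \<open>M\<close> exists even if the rectangle has no rows.\<close>
  obtain M where M: "is_max_row_cover T 1 ?W M"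
    using is_max_cover_exists[of "{1} \<times> ?W" T] unfolding is_max_row_cover_def by auto
  define m where "m = card (dom M)"
  have cover_max: "is_cover T ({1..n\<^sub>h} \<times> ?W) B\<^sub>m\<^sub>a\<^sub>x"
    using assms(5) by (simp add: is_max_cover_def)
  have "card (dom B\<^sub>m\<^sub>a\<^sub>x) = (\<Sum>i\<in>{1..n\<^sub>h}. card (dom (B\<^sub>m\<^sub>a\<^sub>x |` ({i} \<times> ?W))))"
    using cover_max by (intro card_dom_eq_sum_rows) (auto simp: is_cover_def)
  also have "\<dots> \<le> (\<Sum>i\<in>{1..n\<^sub>h}. m)"
  proof (rule sum_mono)
    fix i assume "i \<in> {1..n\<^sub>h}"
    \<comment> \<open>Since \<open>i\<close> is a row of the rectangle, restriction yields a cover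
      of that full row.\<close>
    then have "({1..n\<^sub>h} \<times> ?W) \<inter> ({i} \<times> ?W) = {i} \<times> ?W"
      by auto
    then have "is_cover T ({i} \<times> ?W) (B\<^sub>m\<^sub>a\<^sub>x |` ({i} \<times> ?W))"
      using is_cover_restrict[OF cover_max, of "{i} \<times> ?W"] by simp
    then show "card (dom (B\<^sub>m\<^sub>a\<^sub>x |` ({i} \<times> ?W))) \<le> m"
      unfolding m_def by (rule is_max_row_cover_card_ge[OF M])
  qed
  finally have max_le: "card (dom B\<^sub>m\<^sub>a\<^sub>x) \<le> n\<^sub>h * m"
    by simp
  have "card ?O * m = (\<Sum>i\<in>?O. m)"
    by simp
  also have "\<dots> \<le> (\<Sum>i\<in>?O. card (dom (B\<^sub>c\<^sub>o\<^sub>v |` ({i} \<times> ?W))))"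
  proof (rule sum_mono)
    fix i assume "i \<in> ?O"
    then have "is_max_row_cover T i ?W (B\<^sub>c\<^sub>o\<^sub>v |` ({i} \<times> ?W))"
      using assms(4) by (simp add: is_odd_rows_max_cover_def)
    \<comment> \<open>Here \<open>M\<close> is the competitor, which bounds the row cover from
      below.\<close>
    moreover have "is_cover T ({1} \<times> ?W) M"
      using M by (simp add: is_max_row_cover_def is_max_cover_def)
    ultimately show "m \<le> card (dom (B\<^sub>c\<^sub>o\<^sub>v |` ({i} \<times> ?W)))"
      unfolding m_def by (rule is_max_row_cover_card_ge)
  qed
  \<comment> \<open>Even rows are void, so summing over \<open>?O\<close> counts every tile
    placed.\<close>
  also have "\<dots> = card (dom B\<^sub>c\<^sub>o\<^sub>v)"
    using assms(4) by (intro card_dom_eq_sum_rows[symmetric]) (auto simp: is_odd_rows_max_cover_def)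
  finally have cov_ge: "card ?O * m \<le> card (dom B\<^sub>c\<^sub>o\<^sub>v)" .
  \<comment> \<open>For an odd number of rows this relies on the rounding up in the count of odd
    rows.\<close>
  have "n\<^sub>h \<le> 2 * card ?O"
    unfolding card_odd_atLeastAtMost by simp
  then have "n\<^sub>h * m \<le> 2 * (card ?O * m)"
    by (metis mult.assoc mult_le_mono1)
  then have "card (dom B\<^sub>m\<^sub>a\<^sub>x) \<le> 2 * card (dom B\<^sub>c\<^sub>o\<^sub>v)"
    using max_le cov_ge by linarith
  then show ?thesis
    by linarith
qed

end
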